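(* Fix $\mathbf{w}_0\in\Omega$, $\alpha>1$, $\epsilon_0>0$ with $f(\mathbf{w}_0)-f_*\le\epsilon_0$, and constants $\theta\in(0,1]$, $0<c<\infty$. If $f$ admits a local error bound on $\mathcal{S}_\epsilon$ with constants $\theta$ and $c$, then the iteration complexity of RSG for obtaining a $2\epsilon$-optimal solution is $O\left(\frac{\alpha^2G^2c^2}{\epsilon^{2(1-\theta)}}\lceil\log_\alpha(\frac{\epsilon_0}{\epsilon})\rceil\right)$. Precisely: there is a constant $C>0$ independent of $\epsilon$ such that for every $\epsilon\in(0,\epsilon_0]$ for which $f$ admits a local error bound on $\mathcal{S}_\epsilon$ with constants $\theta,c$, running RSG$(\mathbf{w}_0,K,t,\alpha)$ with $t=\left\lceil\frac{\alpha^2G^2c^2}{\epsilon^{2(1-\theta)}}\right\rceil$ and $K=\lceil\log_\alpha(\epsilon_0/\epsilon)\rceil$ returns $\mathbf{w}_K$ with $f(\mathbf{w}_K)-f_*\le2\epsilon$ after a total number of iterations at most $C\,\frac{\alpha^2G^2c^2}{\epsilon^{2(1-\theta)}}\lceil\log_\alpha(\frac{\epsilon_0}{\epsilon})\rceil$.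
   Context: Problem: $f:\mathbb{R}^d\to(-\infty,+\infty]$ is lower semicontinuous and convex, $\Omega\subseteq\mathrm{dom}(f)$ is a closed convex subset of $\mathbb{R}^d$, $f_*:=\min_{\mathbf{w}\in\Omega}f(\mathbf{w})$ is attained, and $\Omega_*\subseteq\Omega$ is the (nonempty) set of minimizers of $f$ over $\Omega$. No smoothness or strong convexity is assumed. Bounded subgradients: there is a constant $G>0$ such that for every $\mathbf{w}\in\Omega$ the subdifferential $\partial f(\mathbf{w})$ is nonempty and $\|\mathbf{v}\|_2\le G$ for all $\mathbf{v}\in\partial f(\mathbf{w})$. Sublevel set: $\mathcal{S}_\epsilon:=\{\mathbf{w}\in\Omega:f(\mathbf{w})\le f_*+\epsilon\}$. For $\mathbf{w}\in\Omega$, $\mathbf{w}^*$ denotes the point of $\Omega_*$ closest to $\mathbf{w}$ in Euclidean norm. Local error bound: $f$ admits a local error bound on $\mathcal{S}_\epsilon$ with constants $\theta\in(0,1]$ and $0<c<\infty$ if $\|\mathbf{w}-\mathbf{w}^*\|_2\le c\,(f(\mathbf{w})-f_* )^\theta$ for all $\mathbf{w}\in\mathcal{S}_\epsilon$. Algorithm RSG$(\mathbf{w}_0,K,t,\alpha)$ (given $\epsilon_0$ and $G$): for $k=1,\dots,K$ let $\eta_k=\epsilon_0/(\alpha^kG^2)$; set $\mathbf{x}_1=\mathbf{w}_{k-1}$ and, for $\tau=1,\dots,t$, $\mathbf{x}_{\tau+1}=\Pi_\Omega[\mathbf{x}_\tau-\eta_k\mathbf{g}_\tau]$, where $\mathbf{g}_\tau\in\partial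 f(\mathbf{x}_\tau)$ is an arbitrary subgradient returned by an oracle and $\Pi_\Omega$ is the Euclidean projection onto $\Omega$; set $\mathbf{w}_k=\frac1t\sum_{\tau=1}^t\mathbf{x}_\tau$. Output $\mathbf{w}_K$. Each $k$ is a stage; each $\tau$ within a stage is one iteration, so the total number of iterations is $tK$. *)

theory Defs
  imports "HOL-Analysis.Analysis"
begin

definition lsc :: "('a::topological_space \<Rightarrow> ereal) \<Rightarrow> bool" where
  "lsc f \<longleftrightarrow> (\<forall>x. f x \<le> Liminf (at x) f)"

text \<open>In \<open>ereal\<close> we have \<open>0 * \<infinity> = 0\<close>, so the endpoints
  \<open>u = 0\<close> and \<open>u = 1\<close> below impose nothing; they are included only for uniformity.\<close>

definition convex_ereal :: "('a::real_vector \<Rightarrow> ereal) \<Rightarrow> bool" where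
  "convex_ereal f \<longleftrightarrow> (\<forall>x y. \<forall>u\<in>{0..1}.
     f (u *\<^sub>R x + (1 - u) *\<^sub>R y) \<le> ereal u * f x + ereal (1 - u) * f y)"

definition effective_domain :: "('a \<Rightarrow> ereal) \<Rightarrow> 'a set" where
  "effective_domain f = {x. f x < \<infinity>}"

definition subdifferential :: "('a::real_inner \<Rightarrow> ereal) \<Rightarrow> 'a \<Rightarrow> 'a set" where
  "subdifferential f w = {v. \<forall>u. f w + ereal (v \<bullet> (u - w)) \<le> f u}"

definition bounded_subgradients :: "('a::real_inner \<Rightarrow> ereal) \<Rightarrow> 'a set \<Rightarrow> real \<Rightarrow> bool" where
  "bounded_subgradients f \<Omega> G \<longleftrightarrow>
     (\<forall>w\<in>\<Omega>. subdifferential f w \<noteq> {} \<and> (\<forall>v\<in>subdifferential f w. norm v \<le> G))"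

definition minimizers :: "('a \<Rightarrow> ereal) \<Rightarrow> 'a set \<Rightarrow> 'a set" where
  "minimizers f \<Omega> = {w. is_arg_min f (\<lambda>u. u \<in> \<Omega>) w}"

text \<open>The infimum over \<open>\<Omega>\<close>; it is the minimum exactly when \<open>minimizers f \<Omega>\<close> is nonempty.\<close>

definition min_value :: "('a \<Rightarrow> ereal) \<Rightarrow> 'a set \<Rightarrow> ereal" where
  "min_value f \<Omega> = (INF w\<in>\<Omega>. f w)"

definition sublevel_set :: "('a \<Rightarrow> ereal) \<Rightarrow> 'a set \<Rightarrow> real \<Rightarrow> 'a set" where
  "sublevel_set f \<Omega> \<epsilon> = {w \<in> \<Omega>. f w \<le> min_value f \<Omega> + ereal \<epsilon>}"

text \<open>On the sublevel set \<open>f w - min_value f \<Omega>\<close> is finite and nonnegative when the minimum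
  is finite, so \<open>real_of_ereal\<close> loses nothing; \<open>0 powr \<theta> = 0\<close> is the intended value.\<close>

definition local_error_bound ::
  "('a::euclidean_space \<Rightarrow> ereal) \<Rightarrow> 'a set \<Rightarrow> real \<Rightarrow> real \<Rightarrow> real \<Rightarrow> bool" where
  "local_error_bound f \<Omega> \<epsilon> \<theta> c \<longleftrightarrow>
     (\<forall>w\<in>sublevel_set f \<Omega> \<epsilon>.
        norm (w - closest_point (minimizers f \<Omega>) w)
          \<le> c * real_of_ereal (f w - min_value f \<Omega>) powr \<theta>)"

text \<open>\<open>x 1, \<dots>, x (t + 1)\<close> are iterates of \<open>t\<close> steps of the projected subgradient method with
  step size \<open>\<eta>\<close>. The oracle may choose any subgradient at each step, hence a relation
  rather than a function.\<close>

definition projected_subgradient_steps ::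
  "('a::euclidean_space \<Rightarrow> ereal) \<Rightarrow> 'a set \<Rightarrow> real \<Rightarrow> nat \<Rightarrow> (nat \<Rightarrow> 'a) \<Rightarrow> bool" where
  "projected_subgradient_steps f \<Omega> \<eta> t x \<longleftrightarrow>
     (\<forall>\<tau>\<in>{1..t}. \<exists>g\<in>subdifferential f (x \<tau>). x (\<tau> + 1) = closest_point \<Omega> (x \<tau> - \<eta> *\<^sub>R g))"

text \<open>\<open>w 0, \<dots>, w K\<close> are the stage points of a run of RSG; \<open>w K\<close> is the output. Each of the
  \<open>K\<close> stages performs \<open>t\<close> iterations, so such a run takes \<open>t * K\<close> iterations.\<close>

definition RSG_run ::
  "('a::euclidean_space \<Rightarrow> ereal) \<Rightarrow> 'a set \<Rightarrow> real \<Rightarrow> real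
     \<Rightarrow> 'a \<Rightarrow> nat \<Rightarrow> nat \<Rightarrow> real \<Rightarrow> (nat \<Rightarrow> 'a) \<Rightarrow> bool" where
  "RSG_run f \<Omega> G \<epsilon>\<^sub>0 w\<^sub>0 K t \<alpha> w \<longleftrightarrow>
     w 0 = w\<^sub>0 \<and>
     (\<forall>k\<in>{1..K}. \<exists>x.
        x 1 = w (k - 1) \<and>
        projected_subgradient_steps f \<Omega> (\<epsilon>\<^sub>0 / (\<alpha> ^ k * G\<^sup>2)) t x \<and>
        w k = (1 / real t) *\<^sub>R (\<Sum>\<tau>=1..t. x \<tau>))"

end

theory Submission
  imports Defs
begin

text \<open>Write \<open>f\<^sub>*\<close> for the minimum of \<open>f\<close> over \<open>\<Omega>\<close> and \<open>\<epsilon>\<^sub>k = \<epsilon>\<^sub>0 / \<alpha> ^ k\<close>. The run maintains the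
  invariant \<open>f (w k) - f\<^sub>* \<le> \<epsilon>\<^sub>k + \<epsilon>\<close>, which at \<open>k = K\<close> gives \<open>2 * \<epsilon>\<close> since then \<open>\<epsilon>\<^sub>K \<le> \<epsilon>\<close>.

  One stage of \<open>t\<close> projected subgradient steps of size \<open>\<eta>\<close>, started at \<open>x\<close>, satisfies the classical
  bound \<open>f (average) - f u \<le> \<eta> * G\<^sup>2 / 2 + (norm (x - u))\<^sup>2 / (2 * \<eta> * t)\<close> against \<^emph>\<open>every\<close>
  comparison point \<open>u \<in> \<Omega>\<close> (\<open>projected_subgradient_average\<close>). The comparison point is not a minimizer
  but a point \<open>u\<close> of the sublevel set \<open>f u \<le> f\<^sub>* + \<epsilon>\<close> close to \<open>x\<close>. If \<open>f x - f\<^sub>* \<le> \<epsilon>\<^sub>k\<^sub>-\<^sub>1 + \<epsilon>\<close>, there is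
  one at distance at most \<open>c * \<epsilon> powr (\<theta> - 1) * \<epsilon>\<^sub>k\<^sub>-\<^sub>1\<close> (\<open>sublevel_point_near\<close>). With
  \<open>\<eta> = \<epsilon>\<^sub>k / G\<^sup>2\<close> the first term is \<open>\<epsilon>\<^sub>k / 2\<close>, and \<open>t\<close> is large enough to make the second one at most
  \<open>\<epsilon>\<^sub>k / 2\<close>. Hence the average lies at most \<open>\<epsilon>\<^sub>k\<close> above \<open>f u \<le> f\<^sub>* + \<epsilon>\<close>, which is the invariant for \<open>k\<close>.

  The point \<open>u\<close> is found on the segment from \<open>x\<close> to its nearest minimizer \<open>p\<close>. The error bound is
  only local, so it need not hold at \<open>x\<close>; but it applies to \<open>u\<close>, whose nearest minimizer is
  again \<open>p\<close> (\<open>closest_point_on_ray\<close>), and convexity along the segment carries it over to \<open>x\<close>.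

  The constant \<open>C\<close> only absorbs the rounding in \<open>t = \<lceil>A\<rceil>\<close>, where \<open>A\<close> depends on \<open>\<epsilon>\<close>: since
  \<open>\<epsilon> \<le> \<epsilon>\<^sub>0\<close>, \<open>A\<close> is bounded below by its value \<open>A\<^sub>0\<close> at \<open>\<epsilon>\<^sub>0\<close>, so \<open>\<lceil>A\<rceil> \<le> A + 1 \<le> (1 + 1 / A\<^sub>0) * A\<close>.\<close>

section \<open>Real-valued restrictions of extended-real functions\<close>

lemma convex_on_real_of_ereal:
  fixes f :: "'a::real_vector \<Rightarrow> ereal"
  assumes "convex_ereal f" and "convex S" and fin: "\<And>x. x \<in> S \<Longrightarrow> \<bar>f x\<bar> \<noteq> \<infinity>"
  shows "convex_on S (\<lambda>x. real_of_ereal (f x))"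
proof (rule convex_onI)
  fix s :: real and x y assume s: "0 < s" "s < 1" and xy: "x \<in> S" "y \<in> S"
  have z: "(1 - s) *\<^sub>R x + s *\<^sub>R y \<in> S"
    using assms(2) s xy by (simp add: convex_alt)
  have "f ((1 - s) *\<^sub>R x + s *\<^sub>R y) \<le> ereal (1 - s) * f x + ereal s * f y"
    using assms(1)[unfolded convex_ereal_def, rule_format, of "1 - s" x y] s by simp
  then show "real_of_ereal (f ((1 - s) *\<^sub>R x + s *\<^sub>R y))
      \<le> (1 - s) * real_of_ereal (f x) + s * real_of_ereal (f y)"
    using fin[OF xy(1)] fin[OF xy(2)] fin[OF z]
    by (cases "f x"; cases "f y"; cases "f ((1 - s) *\<^sub>R x + s *\<^sub>R y)") auto
qed (use assms in auto)

lemma subdifferential_real_of_ereal: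
  assumes "v \<in> subdifferential f x" and "\<bar>f x\<bar> \<noteq> \<infinity>" and "\<bar>f u\<bar> \<noteq> \<infinity>"
  shows "real_of_ereal (f x) + v \<bullet> (u - x) \<le> real_of_ereal (f u)"
proof -
  have "f x + ereal (v \<bullet> (u - x)) \<le> f u"
    using assms(1) by (simp add: subdifferential_def)
  then show ?thesis
    using assms(2,3) by (cases "f x"; cases "f u") auto
qed

lemma minimizers_iff: "p \<in> minimizers f \<Omega> \<longleftrightarrow> p \<in> \<Omega> \<and> (\<forall>u\<in>\<Omega>. f p \<le> f u)"
  for f :: "'a \<Rightarrow> ereal"
  by (auto simp: minimizers_def is_arg_min_linorder)

lemma min_value_eq: "p \<in> minimizers f \<Omega> \<Longrightarrow> min_value f \<Omega> = f p"
  unfolding min_value_def minimizers_iff by (auto intro!: antisym INF_lower INF_greatest)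

section \<open>The set of minimizers\<close>

text \<open>A limit \<open>x\<close> of minimizers is a minimizer: with a subgradient \<open>v\<close> at \<open>x\<close>, the
  subgradient inequality \<open>f x \<le> f y - v \<bullet> (y - x)\<close> passes to the limit along minimizers \<open>y\<close>.\<close>

lemma closed_minimizers:
  fixes f :: "'a::real_inner \<Rightarrow> ereal"
  assumes fin: "\<And>x. x \<in> \<Omega> \<Longrightarrow> \<bar>f x\<bar> \<noteq> \<infinity>" and "closed \<Omega>"
    and sub: "\<And>x. x \<in> \<Omega> \<Longrightarrow> subdifferential f x \<noteq> {}"
  shows "closed (minimizers f \<Omega>)"
  unfolding closed_sequential_limits
proof (intro allI impI, elim conjE)
  fix X x assume X: "\<forall>n::nat. X n \<in> minimizers f \<Omega>" and lim: "X \<longlonglongrightarrow> x"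
  have XO: "X n \<in> \<Omega>" for n
    using X by (auto simp: minimizers_iff)
  have x: "x \<in> \<Omega>"
    using \<open>closed \<Omega>\<close> XO lim closed_sequential_limits by blast
  obtain v where v: "v \<in> subdifferential f x"
    using sub[OF x] by auto
  have "f x \<le> f u" if u: "u \<in> \<Omega>" for u
  proof -
    have "real_of_ereal (f x) + v \<bullet> (X n - x) \<le> real_of_ereal (f u)" for n
    proof -
      have "f (X n) \<le> f u"
        using X u by (auto simp: minimizers_iff)
      then have "real_of_ereal (f (X n)) \<le> real_of_ereal (f u)"
        using fin[OF XO, of n] fin[OF u] by (cases "f (X n)"; cases "f u") auto
      with subdifferential_real_of_ereal[OF v fin[OF x] fin[OF XO], of n] show ?thesis
        by linarith
    qed
    moreover have "(\<lambda>n. real_of_ereal (f x) + v \<bullet> (X n - x))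
        \<longlonglongrightarrow> real_of_ereal (f x) + v \<bullet> (x - x)"
      by (intro tendsto_intros lim)
    ultimately have "real_of_ereal (f x) + v \<bullet> (x - x) \<le> real_of_ereal (f u)"
      by (intro LIMSEQ_le_const2) auto
    then show ?thesis
      using fin[OF x] fin[OF u] by (cases "f x"; cases "f u") auto
  qed
  with x show "x \<in> minimizers f \<Omega>"
    by (simp add: minimizers_iff)
qed

lemma convex_minimizers:
  fixes f :: "'a::real_vector \<Rightarrow> ereal"
  assumes fin: "\<And>x. x \<in> \<Omega> \<Longrightarrow> \<bar>f x\<bar> \<noteq> \<infinity>" and cf: "convex_ereal f" and "convex \<Omega>"
  shows "convex (minimizers f \<Omega>)"
  unfolding convex_alt
proof (intro ballI allI impI)
  fix x y and s :: real
  assume xy: "x \<in> minimizers f \<Omega>" "y \<in> minimizers f \<Omega>" and s: "0 \<le> s \<and> s \<le> 1"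
  have z: "(1 - s) *\<^sub>R x + s *\<^sub>R y \<in> \<Omega>"
    using xy s \<open>convex \<Omega>\<close> by (auto simp: minimizers_iff convex_alt)
  have O: "x \<in> \<Omega>" "y \<in> \<Omega>" and eq: "f y = f x"
    using xy by (auto simp: minimizers_iff intro: antisym)
  have "real_of_ereal (f ((1 - s) *\<^sub>R x + s *\<^sub>R y))
      \<le> (1 - s) * real_of_ereal (f x) + s * real_of_ereal (f y)"
    using convex_onD[OF convex_on_real_of_ereal[OF cf \<open>convex \<Omega>\<close> fin], of s x y] s O by auto
  then have "real_of_ereal (f ((1 - s) *\<^sub>R x + s *\<^sub>R y)) \<le> real_of_ereal (f x)"
    by (simp add: eq algebra_simps)
  then have "f ((1 - s) *\<^sub>R x + s *\<^sub>R y) \<le> f x"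
    using fin[OF z] fin[OF O(1)]
    by (cases "f x"; cases "f ((1 - s) *\<^sub>R x + s *\<^sub>R y)") auto
  then show "(1 - s) *\<^sub>R x + s *\<^sub>R y \<in> minimizers f \<Omega>"
    using z xy(1) by (auto simp: minimizers_iff intro: order_trans)
qed

section \<open>Using the local error bound outside the sublevel set\<close>

text \<open>The nearest point \<open>p\<close> of \<open>S\<close> is characterised by \<open>w - p\<close> making an obtuse angle with \<open>S\<close> at \<open>p\<close>,
  and this condition depends only on the direction of \<open>w - p\<close>.\<close>

lemma closest_point_on_ray:
  fixes S :: "'a::euclidean_space set"
  assumes "closed S" and "convex S" and "S \<noteq> {}" and "0 \<le> l"
  shows "closest_point S (closest_point S w + l *\<^sub>R (w - closest_point S w)) = closest_point S w"
proof -
  define p where "p = closest_point S w"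
  have p: "p \<in> S"
    unfolding p_def using assms closest_point_in_set by blast
  have "dist (p + l *\<^sub>R (w - p)) p \<le> dist (p + l *\<^sub>R (w - p)) z" if z: "z \<in> S" for z
  proof -
    have "(w - p) \<bullet> (z - p) \<le> 0"
      unfolding p_def using assms z closest_point_dot by blast
    then have "0 \<le> - 2 * (l *\<^sub>R (w - p) \<bullet> (z - p))"
      using \<open>0 \<le> l\<close> by (simp add: mult_nonneg_nonpos)
    moreover have "(norm (l *\<^sub>R (w - p) - (z - p)))\<^sup>2
        = (norm (l *\<^sub>R (w - p)))\<^sup>2 - 2 * (l *\<^sub>R (w - p) \<bullet> (z - p)) + (norm (z - p))\<^sup>2"
      using dot_norm_neg[of "l *\<^sub>R (w - p)" "z - p"] by simp
    moreover have "0 \<le> (norm (z - p))\<^sup>2"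
      by simp
    ultimately have "(norm (l *\<^sub>R (w - p)))\<^sup>2 \<le> (norm (l *\<^sub>R (w - p) - (z - p)))\<^sup>2"
      by linarith
    then have "norm (l *\<^sub>R (w - p)) \<le> norm (l *\<^sub>R (w - p) - (z - p))"
      by (rule power2_le_imp_le) simp
    moreover have "p + l *\<^sub>R (w - p) - z = l *\<^sub>R (w - p) - (z - p)"
      by simp
    ultimately show ?thesis
      by (simp only: dist_norm add_diff_cancel_left')
  qed
  then have "p = closest_point S (p + l *\<^sub>R (w - p))"
    using assms p by (intro closest_point_unique) auto
  then show ?thesis
    by (simp add: p_def)
qed

text \<open>A point \<open>w\<close> whose value exceeds \<open>f\<^sub>* + \<epsilon>\<close> by at most \<open>\<delta>\<close> is contracted towards its nearest
  minimizer \<open>p\<close> by the factor \<open>l = \<epsilon> / (\<epsilon> + \<delta>)\<close>. Convexity puts the result \<open>u\<close> into the sublevel set, where the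
  error bound gives \<open>l * norm (w - p) \<le> c * \<epsilon> powr \<theta>\<close>; the remaining
  distance \<open>norm (w - u)\<close> is \<open>(1 - l) / l = \<delta> / \<epsilon>\<close> times as long.\<close>

lemma sublevel_point_near:
  fixes f :: "'a::euclidean_space \<Rightarrow> ereal"
  assumes fin: "\<And>x. x \<in> \<Omega> \<Longrightarrow> \<bar>f x\<bar> \<noteq> \<infinity>" and cf: "convex_ereal f" and "convex \<Omega>"
    and M: "closed (minimizers f \<Omega>)" "minimizers f \<Omega> \<noteq> {}"
    and leb: "local_error_bound f \<Omega> \<epsilon> \<theta> c"
    and "0 < \<epsilon>" and "0 \<le> \<theta>" and "0 \<le> c" and "0 \<le> \<delta>"
    and w: "w \<in> \<Omega>"
    and fw: "real_of_ereal (f w) \<le> real_of_ereal (min_value f \<Omega>) + \<epsilon> + \<delta>"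
  obtains u where "u \<in> \<Omega>"
    and "real_of_ereal (f u) \<le> real_of_ereal (min_value f \<Omega>) + \<epsilon>"
    and "norm (w - u) \<le> c * \<epsilon> powr (\<theta> - 1) * \<delta>"
proof -
  let ?F = "\<lambda>x. real_of_ereal (f x)"
  define m where "m = real_of_ereal (min_value f \<Omega>)"
  define p where "p = closest_point (minimizers f \<Omega>) w"
  define l where "l = \<epsilon> / (\<epsilon> + \<delta>)"
  define u where "u = p + l *\<^sub>R (w - p)"
  have l: "0 < l" "l \<le> 1"
    using \<open>0 < \<epsilon>\<close> \<open>0 \<le> \<delta>\<close> by (auto simp: l_def intro: divide_pos_pos add_pos_nonneg)
  have p: "p \<in> minimizers f \<Omega>"
    unfolding p_def by (rule closest_point_in_set[OF M])
  then have pO: "p \<in> \<Omega>"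
    by (simp add: minimizers_iff)
  have mv: "min_value f \<Omega> = f p"
    by (rule min_value_eq[OF p])
  have u_eq: "u = (1 - l) *\<^sub>R p + l *\<^sub>R w"
    by (simp add: u_def algebra_simps)
  have uO: "u \<in> \<Omega>"
    unfolding u_eq using \<open>convex \<Omega>\<close> pO w l by (simp add: convex_alt)
  have "?F u \<le> (1 - l) * ?F p + l * ?F w"
    unfolding u_eq
    using convex_onD[OF convex_on_real_of_ereal[OF cf \<open>convex \<Omega>\<close> fin], of l p w] l pO w by auto
  also have "\<dots> \<le> (1 - l) * m + l * (m + \<epsilon> + \<delta>)"
    using fw l by (intro add_mono mult_left_mono) (auto simp: m_def mv)
  also have "\<dots> = m + \<epsilon>"
  proof -
    have "l * (\<epsilon> + \<delta>) = \<epsilon>"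
      using \<open>0 < \<epsilon>\<close> \<open>0 \<le> \<delta>\<close> by (simp add: l_def)
    then show ?thesis
      by (simp add: algebra_simps)
  qed
  finally have Fu: "?F u \<le> m + \<epsilon>" .
  have sub: "u \<in> sublevel_set f \<Omega> \<epsilon>"
    using Fu uO fin[OF uO] fin[OF pO] unfolding sublevel_set_def m_def mv
    by (cases "f u"; cases "f p") auto
  have diff: "real_of_ereal (f u - min_value f \<Omega>) = ?F u - m"
    using fin[OF uO] fin[OF pO] unfolding m_def mv by (cases "f u"; cases "f p") auto
  have "f p \<le> f u"
    using p uO by (simp add: minimizers_iff)
  then have Fu0: "0 \<le> ?F u - m"
    using fin[OF uO] fin[OF pO] unfolding m_def mv by (cases "f u"; cases "f p") auto
  have cpu: "closest_point (minimizers f \<Omega>) u = p"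
    unfolding u_def p_def
    using M convex_minimizers[OF fin cf \<open>convex \<Omega>\<close>] l by (intro closest_point_on_ray) auto
  have "norm (u - p) \<le> c * (?F u - m) powr \<theta>"
    using leb sub cpu unfolding local_error_bound_def diff[symmetric] by force
  also have "\<dots> \<le> c * \<epsilon> powr \<theta>"
    using Fu Fu0 \<open>0 \<le> c\<close> \<open>0 \<le> \<theta>\<close> by (intro mult_left_mono powr_mono2) auto
  finally have up: "norm (u - p) \<le> c * \<epsilon> powr \<theta>" .
  have "w - u = (\<delta> / \<epsilon>) *\<^sub>R (u - p)"
  proof -
    have "w - u = (1 - l) *\<^sub>R (w - p)"
      by (simp add: u_def algebra_simps)
    also have "1 - l = \<delta> / \<epsilon> * l"
      using \<open>0 < \<epsilon>\<close> \<open>0 \<le> \<delta>\<close> by (simp add: l_def field_simps)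
    finally show ?thesis
      by (simp add: u_def)
  qed
  then have "norm (w - u) = \<delta> / \<epsilon> * norm (u - p)"
    using \<open>0 < \<epsilon>\<close> \<open>0 \<le> \<delta>\<close> by simp
  also have "\<dots> \<le> \<delta> / \<epsilon> * (c * \<epsilon> powr \<theta>)"
    using up \<open>0 < \<epsilon>\<close> \<open>0 \<le> \<delta>\<close> by (intro mult_left_mono) auto
  also have "\<dots> = c * \<epsilon> powr (\<theta> - 1) * \<delta>"
    using \<open>0 < \<epsilon>\<close> by (simp add: powr_diff)
  finally show ?thesis
    using that[of u] uO Fu by (simp add: m_def)
qed

section \<open>One stage of the projected subgradient method\<close>

lemma projected_subgradient_steps_in:
  assumes "projected_subgradient_steps f \<Omega> \<eta> t x" and "closed \<Omega>" and "x 1 \<in> \<Omega>"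
    and "1 \<le> \<tau>" and "\<tau> \<le> t + 1"
  shows "x \<tau> \<in> \<Omega>"
  using \<open>1 \<le> \<tau>\<close> \<open>\<tau> \<le> t + 1\<close>
proof (induction \<tau> rule: dec_induct)
  case base
  then show ?case
    using assms(3) by simp
next
  case (step n)
  then obtain g where "x (n + 1) = closest_point \<Omega> (x n - \<eta> *\<^sub>R g)"
    using assms(1) unfolding projected_subgradient_steps_def by force
  then show ?case
    using closest_point_in_set[OF \<open>closed \<Omega>\<close>] assms(3) by auto
qed

text \<open>Projection onto \<open>\<Omega>\<close> does not increase the distance to \<open>u \<in> \<Omega>\<close>, so the cost of a step is that of
  the plain subgradient step, read off by expanding the square.\<close>

lemma projected_subgradient_step:
  fixes f :: "'a::euclidean_space \<Rightarrow> ereal"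
  assumes fin: "\<And>x. x \<in> \<Omega> \<Longrightarrow> \<bar>f x\<bar> \<noteq> \<infinity>" and "closed \<Omega>" and "convex \<Omega>"
    and "0 \<le> \<eta>" and g: "g \<in> subdifferential f x" "norm g \<le> G" and "x \<in> \<Omega>" and "u \<in> \<Omega>"
  shows "2 * \<eta> * (real_of_ereal (f x) - real_of_ereal (f u))
    \<le> (norm (x - u))\<^sup>2 - (norm (closest_point \<Omega> (x - \<eta> *\<^sub>R g) - u))\<^sup>2 + \<eta>\<^sup>2 * G\<^sup>2"
proof -
  have "dist (closest_point \<Omega> (x - \<eta> *\<^sub>R g)) (closest_point \<Omega> u) \<le> dist (x - \<eta> *\<^sub>R g) u"
    using assms by (intro closest_point_lipschitz) auto
  then have "norm (closest_point \<Omega> (x - \<eta> *\<^sub>R g) - u) \<le> norm (x - u - \<eta> *\<^sub>R g)"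
    using \<open>u \<in> \<Omega>\<close> by (simp add: closest_point_self dist_norm algebra_simps)
  then have "(norm (closest_point \<Omega> (x - \<eta> *\<^sub>R g) - u))\<^sup>2 \<le> (norm (x - u - \<eta> *\<^sub>R g))\<^sup>2"
    by (intro power_mono) auto
  also have "\<dots> = (norm (x - u))\<^sup>2 - 2 * \<eta> * (g \<bullet> (x - u)) + \<eta>\<^sup>2 * (norm g)\<^sup>2"
    using dot_norm_neg[of "x - u" "\<eta> *\<^sub>R g"] by (simp add: power_mult_distrib inner_commute)
  finally have "(norm (closest_point \<Omega> (x - \<eta> *\<^sub>R g) - u))\<^sup>2
    \<le> (norm (x - u))\<^sup>2 - 2 * \<eta> * (g \<bullet> (x - u)) + \<eta>\<^sup>2 * (norm g)\<^sup>2" .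
  moreover have "\<eta>\<^sup>2 * (norm g)\<^sup>2 \<le> \<eta>\<^sup>2 * G\<^sup>2"
    using g(2) by (intro mult_left_mono power_mono) auto
  moreover have "2 * \<eta> * (real_of_ereal (f x) - real_of_ereal (f u)) \<le> 2 * \<eta> * (g \<bullet> (x - u))"
    using subdifferential_real_of_ereal[OF g(1) fin fin, of u] assms
    by (intro mult_left_mono) (auto simp: inner_diff_right)
  ultimately show ?thesis
    by linarith
qed

text \<open>The step bounds telescope, and Jensen's inequality passes from the mean of the values to the
  value at the mean.\<close>

lemma projected_subgradient_average:
  fixes f :: "'a::euclidean_space \<Rightarrow> ereal"
  assumes fin: "\<And>x. x \<in> \<Omega> \<Longrightarrow> \<bar>f x\<bar> \<noteq> \<infinity>" and cf: "convex_ereal f"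
    and "closed \<Omega>" and "convex \<Omega>" and bdd: "bounded_subgradients f \<Omega> G"
    and "0 < \<eta>" and "0 < t" and steps: "projected_subgradient_steps f \<Omega> \<eta> t x"
    and x1: "x 1 \<in> \<Omega>" and u: "u \<in> \<Omega>"
  defines "a \<equiv> (1 / real t) *\<^sub>R (\<Sum>\<tau>=1..t. x \<tau>)"
  shows "a \<in> \<Omega>"
    and "real_of_ereal (f a) - real_of_ereal (f u)
      \<le> \<eta> * G\<^sup>2 / 2 + (norm (x 1 - u))\<^sup>2 / (2 * \<eta> * real t)"
proof -
  let ?F = "\<lambda>x. real_of_ereal (f x)"
  have xO: "x \<tau> \<in> \<Omega>" if "1 \<le> \<tau>" "\<tau> \<le> t" for \<tau>
    using projected_subgradient_steps_in[OF steps \<open>closed \<Omega>\<close> x1] that by simp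
  have a: "a = (\<Sum>\<tau>=1..t. (1 / real t) *\<^sub>R x \<tau>)"
    by (simp add: a_def scaleR_right.sum)
  show aO: "a \<in> \<Omega>"
    unfolding a using \<open>convex \<Omega>\<close> \<open>0 < t\<close> xO by (intro convex_sum) auto
  have "2 * \<eta> * (\<Sum>\<tau>=1..n. ?F (x \<tau>) - ?F u)
      \<le> (norm (x 1 - u))\<^sup>2 - (norm (x (n + 1) - u))\<^sup>2 + real n * (\<eta>\<^sup>2 * G\<^sup>2)" if "n \<le> t" for n
    using that
  proof (induction n)
    case (Suc n)
    then obtain g where g: "g \<in> subdifferential f (x (Suc n))"
      and eq: "x (Suc n + 1) = closest_point \<Omega> (x (Suc n) - \<eta> *\<^sub>R g)"
      using steps unfolding projected_subgradient_steps_def by force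
    have xn: "x (Suc n) \<in> \<Omega>"
      using xO Suc.prems by simp
    have gG: "norm g \<le> G"
      using bdd g xn by (simp add: bounded_subgradients_def)
    have "2 * \<eta> * (?F (x (Suc n)) - ?F u)
        \<le> (norm (x (Suc n) - u))\<^sup>2 - (norm (x (Suc n + 1) - u))\<^sup>2 + \<eta>\<^sup>2 * G\<^sup>2"
      unfolding eq using \<open>0 < \<eta>\<close>
      by (intro projected_subgradient_step[OF fin assms(3,4) _ g gG xn u]) auto
    with Suc.IH Suc.prems show ?case
      by (simp add: distrib_left distrib_right)
  qed simp
  from this[of t]
  have sum: "2 * \<eta> * (\<Sum>\<tau>=1..t. ?F (x \<tau>) - ?F u) \<le> (norm (x 1 - u))\<^sup>2 + real t * (\<eta>\<^sup>2 * G\<^sup>2)"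
    using zero_le_power2[of "norm (x (t + 1) - u)"] by linarith
  have "?F a \<le> (\<Sum>\<tau>=1..t. (1 / real t) * ?F (x \<tau>))"
    unfolding a
    using \<open>0 < t\<close> xO convex_on_real_of_ereal[OF cf \<open>convex \<Omega>\<close> fin] by (intro convex_on_sum) auto
  then have "real t * ?F a \<le> (\<Sum>\<tau>=1..t. ?F (x \<tau>))"
    using \<open>0 < t\<close> by (simp add: sum_divide_distrib[symmetric] field_simps)
  then have "real t * (?F a - ?F u) \<le> (\<Sum>\<tau>=1..t. ?F (x \<tau>) - ?F u)"
    by (simp add: sum_subtractf algebra_simps)
  then have "2 * \<eta> * (real t * (?F a - ?F u)) \<le> 2 * \<eta> * (\<Sum>\<tau>=1..t. ?F (x \<tau>) - ?F u)"
    using \<open>0 < \<eta>\<close> by (intro mult_left_mono) auto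
  with sum have "2 * \<eta> * (real t * (?F a - ?F u)) \<le> (norm (x 1 - u))\<^sup>2 + real t * (\<eta>\<^sup>2 * G\<^sup>2)"
    by linarith
  then have "?F a - ?F u \<le> ((norm (x 1 - u))\<^sup>2 + real t * (\<eta>\<^sup>2 * G\<^sup>2)) / (2 * \<eta> * real t)"
    using \<open>0 < t\<close> \<open>0 < \<eta>\<close> by (simp add: pos_le_divide_eq mult_ac)
  also have "\<dots> = \<eta> * G\<^sup>2 / 2 + (norm (x 1 - u))\<^sup>2 / (2 * \<eta> * real t)"
    using \<open>0 < t\<close> \<open>0 < \<eta>\<close> by (simp add: field_simps power2_eq_square)
  finally show "?F a - ?F u \<le> \<eta> * G\<^sup>2 / 2 + (norm (x 1 - u))\<^sup>2 / (2 * \<eta> * real t)" .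
qed

text \<open>A stage reduces the excess \<open>\<alpha> * e\<close> over the level \<open>f\<^sub>* + \<epsilon>\<close> to \<open>e\<close>: measured
  against the point of \<open>sublevel_point_near\<close>, both terms of the averaging bound are at most \<open>e / 2\<close>.\<close>

lemma RSG_stage:
  fixes f :: "'a::euclidean_space \<Rightarrow> ereal"
  assumes fin: "\<And>x. x \<in> \<Omega> \<Longrightarrow> \<bar>f x\<bar> \<noteq> \<infinity>" and cf: "convex_ereal f"
    and cl: "closed \<Omega>" and co: "convex \<Omega>" and ne: "minimizers f \<Omega> \<noteq> {}"
    and "0 < G" and bdd: "bounded_subgradients f \<Omega> G"
    and leb: "local_error_bound f \<Omega> \<epsilon> \<theta> c"
    and "0 < \<epsilon>" and "0 \<le> \<theta>" and "0 < c" and "0 < \<alpha>" and "0 < e"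
    and t: "\<alpha>\<^sup>2 * G\<^sup>2 * c\<^sup>2 / \<epsilon> powr (2 * (1 - \<theta>)) \<le> real t"
    and steps: "projected_subgradient_steps f \<Omega> (e / G\<^sup>2) t x"
    and x1: "x 1 \<in> \<Omega>"
    and fx1: "real_of_ereal (f (x 1)) \<le> real_of_ereal (min_value f \<Omega>) + \<epsilon> + \<alpha> * e"
  defines "a \<equiv> (1 / real t) *\<^sub>R (\<Sum>\<tau>=1..t. x \<tau>)"
  shows "a \<in> \<Omega> \<and> real_of_ereal (f a) \<le> real_of_ereal (min_value f \<Omega>) + \<epsilon> + e"
proof -
  have M: "closed (minimizers f \<Omega>)"
    using closed_minimizers[OF fin cl] bdd by (auto simp: bounded_subgradients_def)
  obtain u where u: "u \<in> \<Omega>"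
    and fu: "real_of_ereal (f u) \<le> real_of_ereal (min_value f \<Omega>) + \<epsilon>"
    and d: "norm (x 1 - u) \<le> c * \<epsilon> powr (\<theta> - 1) * (\<alpha> * e)"
    using sublevel_point_near[OF fin cf co M ne leb, of "\<alpha> * e" "x 1"] assms by auto
  have "0 < \<alpha>\<^sup>2 * G\<^sup>2 * c\<^sup>2 / \<epsilon> powr (2 * (1 - \<theta>))"
    using assms by simp
  with t have t0: "0 < real t"
    by linarith
  have pw: "(\<epsilon> powr (\<theta> - 1))\<^sup>2 = 1 / \<epsilon> powr (2 * (1 - \<theta>))"
    using \<open>0 < \<epsilon>\<close> by (simp add: power2_eq_square powr_add[symmetric] powr_minus_divide[symmetric])
  have "(norm (x 1 - u))\<^sup>2 \<le> (c * \<epsilon> powr (\<theta> - 1) * (\<alpha> * e))\<^sup>2"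
    using d by (intro power_mono) auto
  also have "\<dots> = \<alpha>\<^sup>2 * G\<^sup>2 * c\<^sup>2 / \<epsilon> powr (2 * (1 - \<theta>)) * (e\<^sup>2 / G\<^sup>2)"
    using \<open>0 < G\<close> by (simp add: power_mult_distrib pw)
  also have "\<dots> \<le> real t * (e\<^sup>2 / G\<^sup>2)"
    using t by (intro mult_right_mono) auto
  finally have "(norm (x 1 - u))\<^sup>2 / (2 * (e / G\<^sup>2) * real t)
      \<le> real t * (e\<^sup>2 / G\<^sup>2) / (2 * (e / G\<^sup>2) * real t)"
    using t0 \<open>0 < e\<close> by (intro divide_right_mono) auto
  also have "\<dots> = e / 2"
    using t0 \<open>0 < e\<close> \<open>0 < G\<close> by (simp add: field_simps power2_eq_square)
  finally have dist_term: "(norm (x 1 - u))\<^sup>2 / (2 * (e / G\<^sup>2) * real t) \<le> e / 2" .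
  have "a \<in> \<Omega>" and "real_of_ereal (f a) - real_of_ereal (f u)
      \<le> (e / G\<^sup>2) * G\<^sup>2 / 2 + (norm (x 1 - u))\<^sup>2 / (2 * (e / G\<^sup>2) * real t)"
    unfolding a_def
    using projected_subgradient_average[OF fin cf cl co bdd _ _ steps x1 u] t0 \<open>0 < e\<close> \<open>0 < G\<close>
    by simp_all
  moreover have "(e / G\<^sup>2) * G\<^sup>2 / 2 = e / 2"
    using \<open>0 < G\<close> by simp
  ultimately show ?thesis
    using dist_term fu by (intro conjI) linarith+
qed

section \<open>Iteration complexity\<close>

theorem corollary7:
  fixes f :: "real ^ 'd \<Rightarrow> ereal" and \<Omega> :: "(real ^ 'd) set" and w\<^sub>0 :: "real ^ 'd"
    and G \<alpha> \<epsilon>\<^sub>0 \<theta> c :: real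
  assumes "\<And>x. f x \<noteq> -\<infinity>" and "lsc f" and "convex_ereal f"
    and "\<Omega> \<subseteq> effective_domain f" and "closed \<Omega>" and "convex \<Omega>"
    and "minimizers f \<Omega> \<noteq> {}"
    and "G > 0" and "bounded_subgradients f \<Omega> G"
    and "w\<^sub>0 \<in> \<Omega>" and "\<alpha> > 1" and "\<epsilon>\<^sub>0 > 0"
    and "f w\<^sub>0 - min_value f \<Omega> \<le> ereal \<epsilon>\<^sub>0"
    and "0 < \<theta>" and "\<theta> \<le> 1" and "0 < c"
  shows "\<exists>C>0. \<forall>\<epsilon>. 0 < \<epsilon> \<and> \<epsilon> \<le> \<epsilon>\<^sub>0 \<and> local_error_bound f \<Omega> \<epsilon> \<theta> c \<longrightarrow>
     (let t = nat \<lceil>\<alpha>\<^sup>2 * G\<^sup>2 * c\<^sup>2 / \<epsilon> powr (2 * (1 - \<theta>))\<rceil>;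
          K = nat \<lceil>log \<alpha> (\<epsilon>\<^sub>0 / \<epsilon>)\<rceil>
      in (\<forall>w. RSG_run f \<Omega> G \<epsilon>\<^sub>0 w\<^sub>0 K t \<alpha> w \<longrightarrow>
              f (w K) - min_value f \<Omega> \<le> ereal (2 * \<epsilon>)) \<and>
         real (t * K) \<le> C * (\<alpha>\<^sup>2 * G\<^sup>2 * c\<^sup>2 / \<epsilon> powr (2 * (1 - \<theta>)))
                          * real_of_int \<lceil>log \<alpha> (\<epsilon>\<^sub>0 / \<epsilon>)\<rceil>)"
proof -
  let ?F = "\<lambda>x. real_of_ereal (f x)"
  define m where "m = real_of_ereal (min_value f \<Omega>)"
  have fin: "\<bar>f x\<bar> \<noteq> \<infinity>" if "x \<in> \<Omega>" for x
    using assms(1)[of x] assms(4) that by (cases "f x") (auto simp: effective_domain_def)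
  obtain p where p: "p \<in> minimizers f \<Omega>"
    using assms(7) by auto
  have mv: "min_value f \<Omega> = ereal m"
    using min_value_eq[OF p] fin[of p] p by (cases "f p") (auto simp: m_def minimizers_iff)
  have excess_le_iff: "f x - min_value f \<Omega> \<le> ereal r \<longleftrightarrow> ?F x \<le> m + r" if "x \<in> \<Omega>" for x r
    unfolding mv using fin[OF that] by (cases "f x") auto
  define A where "A \<epsilon> = \<alpha>\<^sup>2 * G\<^sup>2 * c\<^sup>2 / \<epsilon> powr (2 * (1 - \<theta>))" for \<epsilon>
  have A0: "0 < A \<epsilon>" if "0 < \<epsilon>" for \<epsilon>
    using that assms by (simp add: A_def)
  have accuracy: "f (w K) - min_value f \<Omega> \<le> ereal (2 * \<epsilon>)"
    if "0 < \<epsilon>" and leb: "local_error_bound f \<Omega> \<epsilon> \<theta> c"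
      and K: "K = nat \<lceil>log \<alpha> (\<epsilon>\<^sub>0 / \<epsilon>)\<rceil>" and t: "A \<epsilon> \<le> real t"
      and run: "RSG_run f \<Omega> G \<epsilon>\<^sub>0 w\<^sub>0 K t \<alpha> w" for \<epsilon> K t w
  proof -
    have "w k \<in> \<Omega> \<and> ?F (w k) \<le> m + \<epsilon> + \<epsilon>\<^sub>0 / \<alpha> ^ k" if "k \<le> K" for k
      using that
    proof (induction k)
      case 0
      have "w 0 = w\<^sub>0"
        using run by (simp add: RSG_run_def)
      then show ?case
        using assms(10,13) excess_le_iff[of w\<^sub>0 \<epsilon>\<^sub>0] \<open>0 < \<epsilon>\<close> by simp
    next
      case (Suc k)
      have "\<exists>x. x 1 = w (Suc k - 1) \<and>
          projected_subgradient_steps f \<Omega> (\<epsilon>\<^sub>0 / (\<alpha> ^ Suc k * G\<^sup>2)) t x \<and>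
          w (Suc k) = (1 / real t) *\<^sub>R (\<Sum>\<tau>=1..t. x \<tau>)"
        using run Suc.prems unfolding RSG_run_def by (metis atLeastAtMost_iff le_add1 plus_1_eq_Suc)
      then obtain x where x1: "x 1 = w k"
        and steps: "projected_subgradient_steps f \<Omega> (\<epsilon>\<^sub>0 / \<alpha> ^ Suc k / G\<^sup>2) t x"
        and wk: "w (Suc k) = (1 / real t) *\<^sub>R (\<Sum>\<tau>=1..t. x \<tau>)"
        by auto
      have "\<alpha> * (\<epsilon>\<^sub>0 / \<alpha> ^ Suc k) = \<epsilon>\<^sub>0 / \<alpha> ^ k"
        using \<open>\<alpha> > 1\<close> by simp
      with Suc have start: "x 1 \<in> \<Omega>" "?F (x 1) \<le> m + \<epsilon> + \<alpha> * (\<epsilon>\<^sub>0 / \<alpha> ^ Suc k)"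
        unfolding x1 by auto
      then show ?case
        unfolding wk m_def using assms \<open>0 < \<epsilon>\<close> t start(2)
        by (intro RSG_stage[OF fin assms(3,5,6,7,8,9) leb _ _ _ _ _ _ steps start(1),
              where \<alpha> = \<alpha>])
          (auto simp: A_def m_def)
    qed
    then have wK: "w K \<in> \<Omega>" "?F (w K) \<le> m + \<epsilon> + \<epsilon>\<^sub>0 / \<alpha> ^ K"
      by auto
    have "log \<alpha> (\<epsilon>\<^sub>0 / \<epsilon>) \<le> real K"
      unfolding K by (rule real_nat_ceiling_ge)
    then have "\<epsilon>\<^sub>0 / \<epsilon> \<le> \<alpha> ^ K"
      using assms(11,12) \<open>0 < \<epsilon>\<close> by (simp add: log_le_iff powr_realpow)
    then have "\<epsilon>\<^sub>0 / \<alpha> ^ K \<le> \<epsilon>"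
      using assms(11) \<open>0 < \<epsilon>\<close> by (simp add: field_simps)
    with wK show ?thesis
      by (simp add: excess_le_iff)
  qed
  have cost: "real (nat \<lceil>A \<epsilon>\<rceil> * nat \<lceil>log \<alpha> (\<epsilon>\<^sub>0 / \<epsilon>)\<rceil>)
      \<le> (1 + 1 / A \<epsilon>\<^sub>0) * A \<epsilon> * real_of_int \<lceil>log \<alpha> (\<epsilon>\<^sub>0 / \<epsilon>)\<rceil>"
    if "0 < \<epsilon>" "\<epsilon> \<le> \<epsilon>\<^sub>0" for \<epsilon>
  proof -
    have "0 \<le> log \<alpha> (\<epsilon>\<^sub>0 / \<epsilon>)"
      using that assms(11) by simp
    then have K: "real (nat \<lceil>log \<alpha> (\<epsilon>\<^sub>0 / \<epsilon>)\<rceil>) = real_of_int \<lceil>log \<alpha> (\<epsilon>\<^sub>0 / \<epsilon>)\<rceil>"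
      by simp
    have "A \<epsilon>\<^sub>0 \<le> A \<epsilon>"
      unfolding A_def using that assms by (intro divide_left_mono powr_mono2 mult_pos_pos) auto
    then have "1 \<le> 1 / A \<epsilon>\<^sub>0 * A \<epsilon>"
      using A0[of \<epsilon>\<^sub>0] assms(12) by simp
    moreover have "real (nat \<lceil>A \<epsilon>\<rceil>) \<le> A \<epsilon> + 1"
      using A0[OF that(1)] by linarith
    ultimately have "real (nat \<lceil>A \<epsilon>\<rceil>) \<le> (1 + 1 / A \<epsilon>\<^sub>0) * A \<epsilon>"
      by (simp add: distrib_right)
    then show ?thesis
      unfolding of_nat_mult K[symmetric] by (intro mult_right_mono) auto
  qed
  show ?thesis
  proof (rule exI[of _ "1 + 1 / A \<epsilon>\<^sub>0"], intro conjI allI impI, goal_cases)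
    case 1
    then show ?case
      using A0[of \<epsilon>\<^sub>0] assms(12) by (simp add: add_pos_pos)
  next
    case (2 \<epsilon>)
    then show ?case
      unfolding Let_def A_def[symmetric] using accuracy[of \<epsilon>] cost[of \<epsilon>] real_nat_ceiling_ge
      by auto
  qed
qed

end
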